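(* Let $\mathbf{e_1}=(a,b)^T$ and $\mathbf{e_2}=(-b,a)^T$ with $a,b\in\mathbb{R}$, $a^2+b^2=1$. Let $\rho_1,\rho_2$ be positive periodic functions of one real variable such that the scalar density function $\rho(\mathbf{x})=\rho_1(\mathbf{x}\cdot\mathbf{e_1})\,\rho_2(\mathbf{x}\cdot\mathbf{e_2})$ is doubly periodic in $\mathbf{x}$. Let $$\theta_1=\int_0^1\rho_1(s)\,ds,\qquad \theta_2=\int_0^1\rho_2(s)\,ds,\qquad \theta=\theta_1\theta_2,$$ and let $P$ be the doubly-periodic solution, in the sense of the context (unique up to an additive constant), of the Monge-Ampère equation $$\rho(\nabla_{\boldsymbol{\xi}}P(\boldsymbol{\xi}))\,\det\big(D^2_{\boldsymbol{\xi}}P(\boldsymbol{\xi})\big)=\theta=\theta_1\theta_2 .$$ Let $\mathbf{x}(\boldsymbol{\xi})=\nabla_{\boldsymbol{\xi}}P(\boldsymbol{\xi})$ be the associated mesh map, $\mathbf{J}=\partial\mathbf{x}/\partial\boldsymbol{\xi}$ its Jacobian matrix, and $\mathbf{M}=\theta\,\mathbf{J}^{-T}\mathbf{J}^{-1}$ the Metric Tensor to which the mesh aligns. Then at every point $\boldsymbol{\xi}$, writing $\rho_1=\rho_1(\mathbf{x}(\boldsymbol{\xi})\cdot\mathbf{e_1})$ and $\rho_2=\rho_2(\mathbf{x}(\boldsymbol{\xi})\cdot\mathbf{e_2})$: (i) $\displaystyle \mathbf{J}=\frac{\theta_1}{\rho_1}\,\mathbf{e_1}\mathbf{e_1}^T+\frac{\theta_2}{\rho_2}\,\mathbf{e_2}\mathbf{e_2}^T$,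 with eigenvalues (equal to its singular values) $\lambda_1=\theta_1/\rho_1$ and $\lambda_2=\theta_2/\rho_2$; (ii) $\displaystyle \mathbf{M}=\frac{\theta_2\rho_1^2}{\theta_1}\,\mathbf{e_1}\mathbf{e_1}^T+\frac{\theta_1\rho_2^2}{\theta_2}\,\mathbf{e_2}\mathbf{e_2}^T$, with eigenvectors $\mathbf{e_1},\mathbf{e_2}$ and respective eigenvalues $\mu_1=\theta_2\rho_1^2/\theta_1$, $\mu_2=\theta_1\rho_2^2/\theta_2$; equivalently $$\mathbf{M}=\frac{\theta_1\rho_2^2}{\theta_2}\left[I+\left(\frac{\theta_2^2\rho_1^2}{\theta_1^2\rho_2^2}-1\right)\mathbf{e_1}\mathbf{e_1}^T\right];$$ (iii) the anisotropy measure $Q_s=\dfrac{\mathrm{tr}(\mathbf{J}^T\mathbf{J})}{2\det(\mathbf{J}^T\mathbf{J})^{1/2}}$ equals $$Q_s=\frac12\left(\frac{\theta_1\rho_2}{\theta_2\rho_1}+\frac{\theta_2\rho_1}{\theta_1\rho_2}\right).$$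
   Context: The computational and physical domains are $\Omega_c=\Omega_p=[0,1]^2$, with coordinates $\boldsymbol{\xi}=(\xi,\eta)\in\Omega_c$ and $\mathbf{x}=(x,y)\in\Omega_p$. Vectors are column vectors. "Doubly periodic" for $\rho$ means periodic with period $1$ in each of $x$ and $y$. A doubly-periodic solution $P$ of the Monge-Ampère equation means a convex solution whose gradient is a doubly-periodic map from $\Omega_c$ to $\Omega_p$, that is, $P(\boldsymbol{\xi})-\tfrac12|\boldsymbol{\xi}|^2$ is periodic with period $1$ in each of $\xi$ and $\eta$, so that (extending to $\mathbb{R}^2$) $\mathbf{x}=\nabla_{\boldsymbol{\xi}}P$ satisfies $\mathbf{x}(\boldsymbol{\xi}+\mathbf{m})=\mathbf{x}(\boldsymbol{\xi})+\mathbf{m}$ for $\mathbf{m}\in\mathbb{Z}^2$. Here $D^2_{\boldsymbol{\xi}}P$ is the Hessian matrix of $P$. The intended situation is that $\rho_1$ is large when $\mathbf{x}\cdot\mathbf{e_1}=c$ and $\rho_2$ is large when $\mathbf{x}\cdot\mathbf{e_2}=d$, for given constants $c,d$, both being close to $1$ otherwise, so that the density is concentrated along linear features. A mesh map with Jacobian matrix $\mathbf{J}$ is aligned to a symmetric positive definite Metric Tensor $\mathbf{M}$ (is "M-uniform") if $\mathbf{J}^{-T}\mathbf{J}^{-1}=\theta^{-1}\mathbf{M}$.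
   Formalization: The periodic functions ρ₁, ρ₂ are additionally required to have mean over a period equal to θ₁, θ₂, their integrals over [0,1] (automatic for period 1); for other periods the claim is false without this. "Solution" is read as a C² convex solution. *)

theory Defs
  imports
    "HOL-Analysis.Analysis"
    "HOL-Computational_Algebra.Polynomial"
    "HOL-Library.Periodic_Fun"
begin

definition gradient :: "(real^'n \<Rightarrow> real) \<Rightarrow> real^'n \<Rightarrow> real^'n" where
  "gradient f x = (\<chi> i. frechet_derivative f (at x) (axis i 1))"

definition hessian :: "(real^'n \<Rightarrow> real) \<Rightarrow> real^'n \<Rightarrow> real^'n^'n" where
  "hessian f x = jacobian (gradient f) (at x)"

definition twice_continuously_differentiable :: "(real^'n \<Rightarrow> real) \<Rightarrow> bool" where
  "twice_continuously_differentiable f \<longleftrightarrow>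
     (\<forall>x. f differentiable at x) \<and>
     (\<forall>x. gradient f differentiable at x) \<and>
     continuous_on UNIV (hessian f)"

definition doubly_periodic :: "(real^2 \<Rightarrow> 'b) \<Rightarrow> bool" where
  "doubly_periodic f \<longleftrightarrow> (\<forall>x i. f (x + axis i 1) = f x)"

(* The domain [0,1]^2 carries periodic data, so densities and potentials are functions on
   the whole plane. Periodicity of P(xi) - |xi|^2/2 expresses that the gradient of P
   commutes with integer translations and induces a map of the unit square (torus). *)
definition doubly_periodic_MA_solution ::
    "(real^2 \<Rightarrow> real) \<Rightarrow> real \<Rightarrow> (real^2 \<Rightarrow> real) \<Rightarrow> bool" where
  "doubly_periodic_MA_solution \<rho> \<theta> P \<longleftrightarrow>
     twice_continuously_differentiable P \<and>
     convex_on UNIV P \<and>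
     doubly_periodic (\<lambda>\<xi>. P \<xi> - (norm \<xi>)\<^sup>2 / 2) \<and>
     (\<forall>\<xi>. \<rho> (gradient P \<xi>) * det (hessian P \<xi>) = \<theta>)"

(* A periodic function of one variable, of some period T, whose mean over a period is its
   integral over [0,1]. For T = 1 the mean condition is void (see the lemma below). For
   other periods it cannot be dropped: for e1 = (1,1)/sqrt 2 there are densities of period
   1/sqrt 2 whose integrals over [0,1] differ from their means m1, m2 by reciprocal factors;
   the Monge-Ampere equation with right-hand side theta1 * theta2 = m1 * m2 is then
   solvable, but its solution has J = (m1/rho1) e1 e1^T + (m2/rho2) e2 e2^T. *)
definition periodic_with_unit_mean :: "(real \<Rightarrow> real) \<Rightarrow> bool" where
  "periodic_with_unit_mean f \<longleftrightarrow>
     (\<exists>T>0. periodic_fun_simple f T \<and> integral {0..T} f = T * integral {0..1} f)"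

lemma periodic_with_unit_mean_if_period_1:
  assumes "periodic_fun_simple f 1"
  shows "periodic_with_unit_mean f"
  unfolding periodic_with_unit_mean_def using assms by (intro exI[of _ 1]) auto

(* the matrix u v^T *)
definition outer :: "real^'n \<Rightarrow> real^'m \<Rightarrow> real^'m^'n" where
  "outer u v = (columnvector u :: real^1^'n) ** (rowvector v :: real^'m^1)"

definition is_eigenvector :: "real^'n^'n \<Rightarrow> real \<Rightarrow> real^'n \<Rightarrow> bool" where
  "is_eigenvector A \<mu> v \<longleftrightarrow> v \<noteq> 0 \<and> A *v v = \<mu> *s v"

definition char_polynomial :: "real^'n^'n \<Rightarrow> real poly" where
  "char_polynomial A = det (\<chi> i j. (if i = j then [:0, 1:] else 0) - [:A $ i $ j:])"

(* real eigenvalues, counted with algebraic multiplicity *)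
definition eigenvalues :: "real^'n^'n \<Rightarrow> real multiset" where
  "eigenvalues A = proots (char_polynomial A)"

definition singular_values :: "real^'n^'n \<Rightarrow> real multiset" where
  "singular_values A = image_mset sqrt (eigenvalues (transpose A ** A))"

definition metric_tensor :: "real \<Rightarrow> real^'n^'n \<Rightarrow> real^'n^'n" where
  "metric_tensor \<theta> J = \<theta> *\<^sub>R (transpose (matrix_inv J) ** matrix_inv J)"

definition anisotropy :: "real^2^2 \<Rightarrow> real" where
  "anisotropy J = trace (transpose J ** J) / (2 * sqrt (det (transpose J ** J)))"

end

theory Submission
  imports Defs
begin

text \<open>
  The Monge-Ampere equation has a separable solution, whose mesh map rescales each frame coordinate
  on its own; the theorem says that every solution is of this form. The proof compares an arbitrary
  solution with the separable one directly.

  Let \<open>R\<^sub>1\<close>, \<open>R\<^sub>2\<close> be antiderivatives of \<open>\<rho>\<^sub>1 / \<theta>\<^sub>1\<close>, \<open>\<rho>\<^sub>2 / \<theta>\<^sub>2\<close> and let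
  \<open>S y = R\<^sub>1 (y \<bullet> e\<^sub>1) e\<^sub>1 + R\<^sub>2 (y \<bullet> e\<^sub>2) e\<^sub>2\<close>, the inverse, up to a translation, of the
  separable mesh map. Its derivative \<open>A\<close> is diagonal in the frame \<open>e\<^sub>1, e\<^sub>2\<close> with determinant
  \<open>\<rho> / \<theta>\<close>, so the Monge-Ampere equation says exactly that \<open>F = S \<circ> \<nabla>P\<close> has a derivative
  \<open>A H\<close> of determinant 1, with \<open>H\<close> the Hessian of \<open>P\<close>. As \<open>A\<close> is positive definite and \<open>H\<close>
  symmetric and positive semidefinite, the arithmetic-geometric mean inequality gives
  \<open>tr (A H) \<ge> 2\<close>, with equality only for \<open>H = A\<^sup>-\<^sup>1\<close> (lemma \<open>trace_frame_diag_mult_ge_2\<close>).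
  But \<open>F\<close> commutes with integer translations, so \<open>F - id\<close> is periodic and its divergence
  \<open>tr (A H) - 2\<close> has mean zero; being nonnegative it vanishes
  (lemma \<open>periodic_divergence_zero\<close>). Hence \<open>H = A\<^sup>-\<^sup>1\<close> everywhere, which is the formula for \<open>J\<close>
  (lemma \<open>hessian_frame_diag\<close>); all other claims are computations with matrices that are diagonal in
  the frame.

  Two points need care. First, \<open>S\<close> is differentiable only if the density factors are continuous.
  This follows from the equation: \<open>\<rho> \<circ> \<nabla>P = \<theta> / det H\<close> is continuous, and \<open>\<nabla>P\<close> is at bounded
  distance from the identity, hence a closed surjection, so that \<open>\<rho>\<close> is continuous
  (lemma \<open>near_identity_continuous_descends\<close>). Second, \<open>F\<close> commutes with integer translations
  only if \<open>R\<^sub>1 (s + \<alpha>) = R\<^sub>1 s + \<alpha>\<close> for the frame components \<open>\<alpha>\<close> of lattice vectors, which need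
  not be multiples of the given period of \<open>\<rho>\<^sub>1\<close>; the double periodicity of \<open>\<rho>\<close> and the
  condition on the mean yield this (lemmas \<open>product_shift_invariant\<close> and
  \<open>normalised_antiderivative\<close>).
\<close>

section \<open>Matrices diagonal in a rotated frame\<close>

text \<open>
  For \<open>a\<^sup>2 + b\<^sup>2 = 1\<close> these are the symmetric matrices that are diagonal in the orthonormal
  frame \<open>(a, b)\<close>, \<open>(- b, a)\<close>. Products, inverses and transposes stay in this family, so every
  formula of the theorem is a computation with the pair \<open>\<sigma>, \<tau>\<close>.
\<close>

definition frame_diag :: "real \<Rightarrow> real \<Rightarrow> real \<Rightarrow> real \<Rightarrow> real^2^2" where
  "frame_diag a b \<sigma> \<tau> =
     \<sigma> *\<^sub>R outer (vector [a, b]) (vector [a, b]) + \<tau> *\<^sub>R outer (vector [- b, a]) (vector [- b, a])"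

lemma outer_component: "outer u v $ i $ j = u $ i * v $ j"
  by (simp add: outer_def matrix_matrix_mult_def columnvector_def rowvector_def)

lemma frame_diag_components:
  "frame_diag a b \<sigma> \<tau> $ 1 $ 1 = \<sigma> * a\<^sup>2 + \<tau> * b\<^sup>2"
  "frame_diag a b \<sigma> \<tau> $ 1 $ 2 = (\<sigma> - \<tau>) * a * b"
  "frame_diag a b \<sigma> \<tau> $ 2 $ 1 = (\<sigma> - \<tau>) * a * b"
  "frame_diag a b \<sigma> \<tau> $ 2 $ 2 = \<sigma> * b\<^sup>2 + \<tau> * a\<^sup>2"
  by (simp_all add: frame_diag_def outer_component power2_eq_square algebra_simps)

lemmas matrix_2_simps = vec_eq_iff forall_2 matrix_matrix_mult_def sum_2 mat_def

lemma transpose_frame_diag: "transpose (frame_diag a b \<sigma> \<tau>) = frame_diag a b \<sigma> \<tau>"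
  by (simp add: matrix_2_simps frame_diag_components transpose_def)

lemma scaleR_frame_diag: "c *\<^sub>R frame_diag a b \<sigma> \<tau> = frame_diag a b (c * \<sigma>) (c * \<tau>)"
  by (simp add: frame_diag_def scaleR_add_right)

lemma frame_diag_mult_vec:
  "frame_diag a b \<sigma> \<tau> *v h =
     (\<sigma> * (h \<bullet> vector [a, b])) *\<^sub>R vector [a, b] + (\<tau> * (h \<bullet> vector [- b, a])) *\<^sub>R vector [- b, a]"
  by (simp add: vec_eq_iff forall_2 matrix_vector_mult_def sum_2 frame_diag_components
      inner_vec_def power2_eq_square algebra_simps)

context
  fixes a b :: real
  assumes unit: "a\<^sup>2 + b\<^sup>2 = 1"
begin

lemma frame_diag_mult:
  "frame_diag a b \<sigma> \<tau> ** frame_diag a b \<sigma>' \<tau>' = frame_diag a b (\<sigma> * \<sigma>') (\<tau> * \<tau>')"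
  using unit by (simp add: matrix_2_simps frame_diag_components) algebra

lemma frame_diag_1: "frame_diag a b 1 1 = mat 1"
  using unit by (simp add: matrix_2_simps frame_diag_components add.commute)

lemma trace_frame_diag: "trace (frame_diag a b \<sigma> \<tau>) = \<sigma> + \<tau>"
  using unit unfolding trace_def sum_2 frame_diag_components by algebra

lemma det_frame_diag: "det (frame_diag a b \<sigma> \<tau>) = \<sigma> * \<tau>"
  using unit unfolding det_2 frame_diag_components by algebra

lemma eigenvalues_frame_diag: "eigenvalues (frame_diag a b \<sigma> \<tau>) = {#\<sigma>, \<tau>#}"
proof -
  let ?A = "frame_diag a b \<sigma> \<tau>"
  have "char_polynomial ?A = [:det ?A, - trace ?A, 1:]"
    unfolding char_polynomial_def det_2 trace_def sum_2 by simp
  also have "\<dots> = [:- \<sigma>, 1:] * [:- \<tau>, 1:]"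
    by (simp add: det_frame_diag trace_frame_diag)
  finally show ?thesis
    unfolding eigenvalues_def by (simp add: proots_mult del: mult_pCons_left mult_pCons_right)
qed

lemma singular_values_frame_diag:
  assumes "\<sigma> \<ge> 0" "\<tau> \<ge> 0"
  shows "singular_values (frame_diag a b \<sigma> \<tau>) = {#\<sigma>, \<tau>#}"
  using assms
  by (simp add: singular_values_def transpose_frame_diag frame_diag_mult eigenvalues_frame_diag)

lemma is_eigenvector_frame_diag:
  "is_eigenvector (frame_diag a b \<sigma> \<tau>) \<sigma> (vector [a, b])"
  "is_eigenvector (frame_diag a b \<sigma> \<tau>) \<tau> (vector [- b, a])"
proof -
  have "vector [a, b] \<noteq> (0 :: real^2)" "vector [- b, a] \<noteq> (0 :: real^2)"
    using unit by (auto simp: vec_eq_iff forall_2)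
  then show "is_eigenvector (frame_diag a b \<sigma> \<tau>) \<sigma> (vector [a, b])"
    "is_eigenvector (frame_diag a b \<sigma> \<tau>) \<tau> (vector [- b, a])"
    using unit unfolding is_eigenvector_def frame_diag_mult_vec
    by (auto simp: inner_vec_def sum_2 scalar_mult_eq_scaleR power2_eq_square algebra_simps)
qed

lemma metric_tensor_frame_diag:
  assumes "\<sigma> \<noteq> 0" "\<tau> \<noteq> 0"
  shows "metric_tensor \<theta> (frame_diag a b \<sigma> \<tau>) = frame_diag a b (\<theta> / \<sigma>\<^sup>2) (\<theta> / \<tau>\<^sup>2)"
proof -
  have "frame_diag a b \<sigma> \<tau> ** frame_diag a b (1 / \<sigma>) (1 / \<tau>) = mat 1"
    "frame_diag a b (1 / \<sigma>) (1 / \<tau>) ** frame_diag a b \<sigma> \<tau> = mat 1"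
    using assms by (simp_all add: frame_diag_mult frame_diag_1)
  then have "matrix_inv (frame_diag a b \<sigma> \<tau>) = frame_diag a b (1 / \<sigma>) (1 / \<tau>)"
    unfolding matrix_inv_def
    by (intro some_equality) (auto, metis matrix_mul_assoc matrix_mul_lid matrix_mul_rid)
  then show ?thesis
    by (simp add: metric_tensor_def transpose_frame_diag frame_diag_mult scaleR_frame_diag power2_eq_square)
qed

lemma anisotropy_frame_diag:
  assumes "\<sigma> > 0" "\<tau> > 0"
  shows "anisotropy (frame_diag a b \<sigma> \<tau>) = 1 / 2 * (\<sigma> / \<tau> + \<tau> / \<sigma>)"
  using assms
  by (simp add: anisotropy_def transpose_frame_diag frame_diag_mult trace_frame_diag det_frame_diag
      real_sqrt_mult field_simps)

lemma frame_diag_rank_one_update: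
  assumes "\<tau> \<noteq> 0"
  shows "frame_diag a b \<sigma> \<tau> = \<tau> *\<^sub>R (mat 1 + (\<sigma> / \<tau> - 1) *\<^sub>R outer (vector [a, b]) (vector [a, b]))"
  unfolding frame_diag_1[symmetric] using assms
  by (simp add: frame_diag_def algebra_simps flip: scaleR_left_distrib)

text \<open>
  Arithmetic-geometric mean inequality in matrix form, for \<open>A = frame_diag a b \<alpha> \<beta>\<close> and \<open>H\<close> with
  \<open>det (A ** H) = 1\<close>. With \<open>p, q\<close> the diagonal entries and \<open>r\<close> the off-diagonal entry of \<open>H\<close> in
  the frame, the trace is \<open>\<alpha> * p + \<beta> * q\<close>, and the determinant condition
  \<open>\<alpha> * \<beta> * (p * q - r\<^sup>2) = 1\<close> turns its square into \<open>4\<close> plus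
  \<open>(\<alpha> * p - \<beta> * q)\<^sup>2 + 4 * \<alpha> * \<beta> * r\<^sup>2\<close>. In the equality case both extra terms vanish,
  which leaves \<open>r = 0\<close> and \<open>\<alpha> * p = \<beta> * q = 1\<close>.
\<close>

lemma trace_frame_diag_mult_ge_2:
  fixes H :: "real^2^2"
  assumes sym: "H $ 1 $ 2 = H $ 2 $ 1"
    and psd: "\<And>h. h \<bullet> (H *v h) \<ge> 0"
    and pos: "\<alpha> > 0" "\<beta> > 0"
    and det: "\<alpha> * \<beta> * det H = 1"
  shows "trace (frame_diag a b \<alpha> \<beta> ** H) \<ge> 2"
    and "trace (frame_diag a b \<alpha> \<beta> ** H) = 2 \<Longrightarrow> H = frame_diag a b (1 / \<alpha>) (1 / \<beta>)"
proof -
  define p where "p = H$1$1 * a\<^sup>2 + 2 * H$1$2 * a * b + H$2$2 * b\<^sup>2"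
  define q where "q = H$1$1 * b\<^sup>2 - 2 * H$1$2 * a * b + H$2$2 * a\<^sup>2"
  define r where "r = (H$2$2 - H$1$1) * a * b + H$1$2 * (a\<^sup>2 - b\<^sup>2)"
  have p0: "p \<ge> 0"
    using psd[of "vector [a, b]"] sym
    by (simp add: p_def inner_vec_def matrix_vector_mult_def sum_2 power2_eq_square algebra_simps)
  have q0: "q \<ge> 0"
    using psd[of "vector [- b, a]"] sym
    by (simp add: q_def inner_vec_def matrix_vector_mult_def sum_2 power2_eq_square algebra_simps)
  have detpq: "det H = p * q - r\<^sup>2"
    using unit sym unfolding det_2 p_def q_def r_def by algebra
  have tr: "trace (frame_diag a b \<alpha> \<beta> ** H) = \<alpha> * p + \<beta> * q"
    using sym by (simp add: trace_def matrix_matrix_mult_def sum_2 frame_diag_components p_def q_def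
        power2_eq_square algebra_simps)
  have key: "(\<alpha> * p + \<beta> * q)\<^sup>2 = 2\<^sup>2 + (\<alpha> * p - \<beta> * q)\<^sup>2 + 4 * (\<alpha> * \<beta> * r\<^sup>2)"
    using det unfolding detpq by algebra
  have "2\<^sup>2 \<le> (\<alpha> * p + \<beta> * q)\<^sup>2"
    unfolding key using pos by simp
  then show "trace (frame_diag a b \<alpha> \<beta> ** H) \<ge> 2"
    unfolding tr by (rule power2_le_imp_le) (use p0 q0 pos in simp)
  assume "trace (frame_diag a b \<alpha> \<beta> ** H) = 2"
  then have s: "\<alpha> * p + \<beta> * q = 2" by (simp add: tr)
  have z: "(\<alpha> * p - \<beta> * q)\<^sup>2 + 4 * (\<alpha> * \<beta> * r\<^sup>2) = 0" using key s by simp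
  have nn: "4 * (\<alpha> * \<beta> * r\<^sup>2) \<ge> 0" using pos by simp
  have "(\<alpha> * p - \<beta> * q)\<^sup>2 = 0" using z nn by (smt (verit) zero_le_power2)
  moreover have "\<alpha> * \<beta> * r\<^sup>2 = 0" using z nn by (smt (verit) zero_le_power2)
  ultimately have "\<alpha> * p = 1" "\<beta> * q = 1" "r = 0" using s pos by auto
  then have pqr: "1 / \<alpha> = p" "1 / \<beta> = q" "r = 0" using pos by (auto simp: field_simps)
  have "H$1$1 = p * a\<^sup>2 + q * b\<^sup>2" "H$1$2 = (p - q) * a * b" "H$2$2 = p * b\<^sup>2 + q * a\<^sup>2"
    using unit \<open>r = 0\<close> unfolding p_def q_def r_def by algebra+
  then show "H = frame_diag a b (1 / \<alpha>) (1 / \<beta>)"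
    unfolding pqr using sym by (simp add: vec_eq_iff forall_2 frame_diag_components)
qed

end

lemma frame_expansion:
  assumes "a\<^sup>2 + b\<^sup>2 = 1"
  shows "(h \<bullet> vector [a, b]) *\<^sub>R vector [a, b] + (h \<bullet> vector [- b, a]) *\<^sub>R vector [- b, a] = (h :: real^2)"
  using frame_diag_mult_vec[of a b 1 1 h] frame_diag_1[OF assms] by simp

section \<open>Gradient and Hessian\<close>

lemma has_real_derivative_along_line:
  fixes f :: "'a::real_normed_vector \<Rightarrow> real"
  assumes "(f has_derivative f') (at (y + s *\<^sub>R u))"
  shows "((\<lambda>s. f (y + s *\<^sub>R u)) has_real_derivative f' u) (at s)"
proof -
  have "((\<lambda>s. y + s *\<^sub>R u) has_derivative (\<lambda>k. k *\<^sub>R u)) (at s)"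
    by (auto intro!: derivative_eq_intros)
  from has_derivative_compose[OF this assms] show ?thesis
    using linear_scale[OF has_derivative_linear[OF assms]]
    by (simp add: has_field_derivative_def mult_commute_abs)
qed

lemma gradient_has_derivative:
  fixes P :: "real^'n \<Rightarrow> real"
  assumes "P differentiable at y"
  shows "(P has_derivative (\<lambda>h. gradient P y \<bullet> h)) (at y)"
proof -
  let ?D = "frechet_derivative P (at y)"
  have D: "(P has_derivative ?D) (at y)"
    using assms by (simp add: frechet_derivative_works)
  have "?D h = gradient P y \<bullet> h" for h
  proof -
    have "?D h = ?D (\<Sum>i\<in>UNIV. (h $ i) *\<^sub>R axis i 1)"
      using basis_expansion[of h] by (simp add: scalar_mult_eq_scaleR)
    also have "\<dots> = (\<Sum>i\<in>UNIV. h $ i * ?D (axis i 1))"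
      using has_derivative_linear[OF D] by (simp add: linear_sum linear_scale)
    finally show ?thesis
      by (simp add: gradient_def inner_vec_def mult.commute)
  qed
  then have "?D = (\<lambda>h. gradient P y \<bullet> h)" by (rule ext)
  then show ?thesis using D by simp
qed

lemma gradient_unique:
  assumes "(P has_derivative (\<lambda>h. g \<bullet> h)) (at y)"
  shows "gradient P y = g"
  by (simp add: gradient_def vec_eq_iff inner_axis flip: frechet_derivative_at[OF assms])

text \<open>
  The left-hand side of the final equation is unchanged when \<open>u\<close> and \<open>v\<close> are exchanged; this is
  what makes the Hessian symmetric in the next lemma.
\<close>

lemma second_difference_mvt:
  fixes P :: "real^'n \<Rightarrow> real"
  assumes P: "\<And>y. P differentiable at y" and g: "\<And>y. gradient P differentiable at y" and "h > 0"
  obtains s t where "0 < s" "s < h" "0 < t" "t < h"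
    "P (y + h *\<^sub>R u + h *\<^sub>R v) - P (y + h *\<^sub>R u) - (P (y + h *\<^sub>R v) - P y) =
       h\<^sup>2 * (u \<bullet> (hessian P (y + s *\<^sub>R u + t *\<^sub>R v) *v v))"
proof -
  note Pd = gradient_has_derivative[OF P]
  have Hd: "(gradient P has_derivative (\<lambda>k. hessian P z *v k)) (at z)" for z
    using g[of z] by (simp add: jacobian_works hessian_def)
  define \<phi> where "\<phi> s = P (y + s *\<^sub>R u + h *\<^sub>R v) - P (y + s *\<^sub>R u)" for s
  have "(\<phi> has_real_derivative (gradient P (y + s *\<^sub>R u + h *\<^sub>R v) \<bullet> u - gradient P (y + s *\<^sub>R u) \<bullet> u)) (at s)" for s
    unfolding \<phi>_def add.commute[of "y + _" "h *\<^sub>R v"] add.assoc[symmetric]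
    by (intro DERIV_diff has_real_derivative_along_line[OF Pd])
  from MVT2[OF \<open>h > 0\<close> this] obtain s where s: "0 < s" "s < h"
    "\<phi> h - \<phi> 0 = h * (gradient P (y + s *\<^sub>R u + h *\<^sub>R v) \<bullet> u - gradient P (y + s *\<^sub>R u) \<bullet> u)"
    by auto
  define \<psi> where "\<psi> t = gradient P (y + s *\<^sub>R u + t *\<^sub>R v) \<bullet> u" for t
  have "(\<psi> has_real_derivative ((hessian P (y + s *\<^sub>R u + t *\<^sub>R v) *v v) \<bullet> u)) (at t)" for t
    unfolding \<psi>_def
    by (rule has_real_derivative_along_line[OF has_derivative_inner_left[OF Hd]])
  from MVT2[OF \<open>h > 0\<close> this] obtain t where t: "0 < t" "t < h"
    "\<psi> h - \<psi> 0 = h * ((hessian P (y + s *\<^sub>R u + t *\<^sub>R v) *v v) \<bullet> u)"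
    by auto
  show ?thesis
    using s t by (intro that[of s t]) (auto simp: \<phi>_def \<psi>_def inner_commute power2_eq_square)
qed

text \<open>
  The second difference of \<open>P\<close> over the parallelogram with sides \<open>h *\<^sub>R u\<close> and \<open>h *\<^sub>R v\<close>, divided by
  \<open>h\<^sup>2\<close>, is a value of each of the two bilinear expressions at some point of the parallelogram.
  As \<open>h\<close> tends to \<open>0\<close> along \<open>1 / (n + 1)\<close>, both values tend to those at \<open>y\<close> because the
  Hessian is continuous.
\<close>

lemma hessian_symmetric:
  fixes P :: "real^'n \<Rightarrow> real"
  assumes "twice_continuously_differentiable P"
  shows "u \<bullet> (hessian P y *v v) = v \<bullet> (hessian P y *v u)"
proof -
  have P: "\<And>y. P differentiable at y" and g: "\<And>y. gradient P differentiable at y"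
    and H: "continuous_on UNIV (hessian P)"
    using assms by (auto simp: twice_continuously_differentiable_def)
  define d where "d n = inverse (real (Suc n))" for n
  have d0: "d n > 0" for n by (simp add: d_def)
  have dlim: "d \<longlonglongrightarrow> 0" unfolding d_def by (rule LIMSEQ_inverse_real_of_nat)
  let ?H = "\<lambda>s t. hessian P (y + s *\<^sub>R u + t *\<^sub>R v)"
  have ex: "\<exists>s t s' t'. (0 < s \<and> s < d n) \<and> (0 < t \<and> t < d n) \<and> (0 < s' \<and> s' < d n) \<and> (0 < t' \<and> t' < d n) \<and>
      u \<bullet> (?H s t *v v) = v \<bullet> (?H s' t' *v u)" for n
  proof -
    obtain s t where st: "0 < s" "s < d n" "0 < t" "t < d n"
      "P (y + d n *\<^sub>R u + d n *\<^sub>R v) - P (y + d n *\<^sub>R u) - (P (y + d n *\<^sub>R v) - P y) =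
         (d n)\<^sup>2 * (u \<bullet> (?H s t *v v))"
      using second_difference_mvt[OF P g d0] by blast
    obtain t' s' where st': "0 < t'" "t' < d n" "0 < s'" "s' < d n"
      "P (y + d n *\<^sub>R v + d n *\<^sub>R u) - P (y + d n *\<^sub>R v) - (P (y + d n *\<^sub>R u) - P y) =
         (d n)\<^sup>2 * (v \<bullet> (hessian P (y + t' *\<^sub>R v + s' *\<^sub>R u) *v u))"
      using second_difference_mvt[OF P g d0] by blast
    have swap: "y + c *\<^sub>R v + e *\<^sub>R u = y + e *\<^sub>R u + c *\<^sub>R v" for c e by simp
    have "(d n)\<^sup>2 * (u \<bullet> (?H s t *v v)) = (d n)\<^sup>2 * (v \<bullet> (?H s' t' *v u))"
      using st(5) st'(5)
      unfolding swap by linarith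
    then have "u \<bullet> (?H s t *v v) = v \<bullet> (?H s' t' *v u)" using d0[of n] by simp
    with st st' show ?thesis by blast
  qed
  then obtain s t s' t' where
    b: "\<And>n. 0 < s n \<and> s n < d n" "\<And>n. 0 < t n \<and> t n < d n" "\<And>n. 0 < s' n \<and> s' n < d n" "\<And>n. 0 < t' n \<and> t' n < d n"
    and eq: "\<And>n. u \<bullet> (?H (s n) (t n) *v v) = v \<bullet> (?H (s' n) (t' n) *v u)"
    by metis
  have lim0: "c \<longlonglongrightarrow> 0" if "\<And>n. 0 < c n \<and> c n < d n" for c :: "nat \<Rightarrow> real"
    by (rule tendsto_sandwich[OF _ _ tendsto_const dlim]) (use that in \<open>auto intro!: always_eventually less_imp_le\<close>)
  have Hlim: "(\<lambda>n. ?H (c n) (e n)) \<longlonglongrightarrow> hessian P y" if "c \<longlonglongrightarrow> 0" "e \<longlonglongrightarrow> 0" for c e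
  proof (rule continuous_on_tendsto_compose[OF H])
    show "(\<lambda>n. y + c n *\<^sub>R u + e n *\<^sub>R v) \<longlonglongrightarrow> y"
      using that by (auto intro!: tendsto_eq_intros)
  qed auto
  have bl: "bounded_linear (\<lambda>A. w \<bullet> (A *v z))" for w z :: "real^'n"
    by (rule linear_conv_bounded_linear[THEN iffD1])
       (auto intro!: linearI simp: matrix_vector_mult_add_rdistrib inner_right_distrib scaleR_matrix_vector_assoc[symmetric])
  have "(\<lambda>n. u \<bullet> (?H (s n) (t n) *v v)) \<longlonglongrightarrow> u \<bullet> (hessian P y *v v)"
    by (intro bounded_linear.tendsto[OF bl] Hlim lim0 b)
  moreover have "(\<lambda>n. v \<bullet> (?H (s' n) (t' n) *v u)) \<longlonglongrightarrow> v \<bullet> (hessian P y *v u)"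
    by (intro bounded_linear.tendsto[OF bl] Hlim lim0 b)
  ultimately show ?thesis
    unfolding eq by (rule LIMSEQ_unique)
qed

text \<open>
  Restricted to a line, \<open>P\<close> is a convex function of one variable; its tangents lie below its
  graph, so its derivative is monotone and its second derivative is nonnegative.
\<close>

lemma hessian_psd:
  fixes P :: "real^'n \<Rightarrow> real"
  assumes c2: "twice_continuously_differentiable P" and conv: "convex_on UNIV P"
  shows "h \<bullet> (hessian P y *v h) \<ge> 0"
proof -
  have P: "\<And>z. P differentiable at z"
    using c2 by (simp add: twice_continuously_differentiable_def)
  note Pd = gradient_has_derivative[OF P]
  have Hd: "(gradient P has_derivative (\<lambda>k. hessian P z *v k)) (at z)" for z
    using c2 by (simp add: jacobian_works hessian_def twice_continuously_differentiable_def)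
  define \<phi> where "\<phi> s = P (y + s *\<^sub>R h)" for s
  define \<phi>' where "\<phi>' s = gradient P (y + s *\<^sub>R h) \<bullet> h" for s
  have d1: "(\<phi> has_real_derivative \<phi>' s) (at s)" for s
    unfolding \<phi>_def \<phi>'_def by (rule has_real_derivative_along_line[OF Pd])
  have d2: "(\<phi>' has_real_derivative ((hessian P (y + s *\<^sub>R h) *v h) \<bullet> h)) (at s)" for s
    unfolding \<phi>'_def
    by (rule has_real_derivative_along_line[OF has_derivative_inner_left[OF Hd]])
  have cv: "convex_on UNIV \<phi>"
  proof (intro convex_onI)
    fix t x z :: real assume "0 < t" "t < 1"
    have "y + ((1 - t) * x + t * z) *\<^sub>R h = (1 - t) *\<^sub>R (y + x *\<^sub>R h) + t *\<^sub>R (y + z *\<^sub>R h)"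
      by (simp add: algebra_simps)
    then show "\<phi> ((1 - t) *\<^sub>R x + t *\<^sub>R z) \<le> (1 - t) * \<phi> x + t * \<phi> z"
      using convex_onD[OF conv, of t "y + x *\<^sub>R h" "y + z *\<^sub>R h"] \<open>0 < t\<close> \<open>t < 1\<close>
      by (simp add: \<phi>_def)
  qed auto
  have tan: "\<phi> z - \<phi> x \<ge> \<phi>' x * (z - x)" for x z
    by (rule convex_on_imp_above_tangent[OF cv]) (auto intro: d1)
  have "mono \<phi>'"
  proof (rule monoI)
    fix x z :: real assume "x \<le> z"
    have "(\<phi>' z - \<phi>' x) * (z - x) \<ge> 0"
      using tan[where x = x and z = z] tan[where x = z and z = x] by (simp add: algebra_simps)
    then show "\<phi>' x \<le> \<phi>' z"
      using \<open>x \<le> z\<close> by (cases "x = z") (auto simp: zero_le_mult_iff)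
  qed
  then have "(hessian P (y + 0 *\<^sub>R h) *v h) \<bullet> h \<ge> 0"
    by (intro mono_on_imp_deriv_nonneg[OF _ d2, of UNIV]) auto
  then show ?thesis by (simp add: inner_commute)
qed

text \<open>
  The quadratic part of \<open>P\<close> changes by an affine function with gradient \<open>axis i 1\<close> under the
  translation, the rest by nothing.
\<close>

lemma gradient_shift:
  assumes diff: "\<And>y. P differentiable at y"
    and per: "doubly_periodic (\<lambda>\<xi>. P \<xi> - (norm \<xi>)\<^sup>2 / 2)"
  shows "gradient P (\<xi> + axis i 1) = gradient P \<xi> + axis i 1"
proof -
  let ?e = "axis i 1 :: real^2"
  have shift: "P (y + ?e) = P y + (y \<bullet> ?e + 1 / 2)" for y
    using per unfolding doubly_periodic_def power2_norm_eq_inner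
    by (auto simp: inner_add_left inner_add_right inner_commute inner_axis_axis
        field_simps dest!: spec[of _ y] spec[of _ i])
  have "((\<lambda>y. P y + (y \<bullet> ?e + 1 / 2)) has_derivative (\<lambda>h. (gradient P \<xi> + ?e) \<bullet> h)) (at \<xi>)"
    by (auto intro!: derivative_eq_intros gradient_has_derivative[OF diff]
        simp: inner_add_left inner_add_right inner_commute)
  then have *: "((\<lambda>y. P (y + ?e)) has_derivative (\<lambda>h. (gradient P \<xi> + ?e) \<bullet> h)) (at \<xi>)"
    by (simp add: shift)
  have "((\<lambda>y. y - ?e) has_derivative (\<lambda>h. h)) (at (\<xi> + ?e))"
    by (auto intro!: derivative_eq_intros)
  from has_derivative_compose[OF this, of "\<lambda>y. P (y + ?e)" "\<lambda>h. (gradient P \<xi> + ?e) \<bullet> h"] *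
  have "(P has_derivative (\<lambda>h. (gradient P \<xi> + ?e) \<bullet> h)) (at (\<xi> + ?e))"
    by simp
  then show ?thesis by (rule gradient_unique)
qed

section \<open>Periodic functions\<close>

lemma doubly_periodic_bounded:
  fixes q :: "real^2 \<Rightarrow> 'b::metric_space"
  assumes cont: "continuous_on UNIV q" and per: "doubly_periodic q"
  shows "bounded (range q)"
proof -
  have shift: "q (x + of_int k *\<^sub>R axis i 1) = q x" for x :: "real^2" and k i
  proof -
    interpret periodic_fun_simple "\<lambda>s. q (x + s *\<^sub>R axis i 1)" "1 :: real"
    proof
      fix s :: real
      have "x + (s + 1) *\<^sub>R axis i 1 = (x + s *\<^sub>R axis i 1) + axis i 1" by (simp add: algebra_simps)
      then show "q (x + (s + 1) *\<^sub>R axis i 1) = q (x + s *\<^sub>R axis i 1)"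
        using per unfolding doubly_periodic_def by presburger
    qed
    show ?thesis using plus_of_int[of 0 k] by simp
  qed
  have "q x \<in> q ` cbox 0 1" for x
  proof -
    define w :: "real^2" where "w = (\<chi> i. frac (x $ i))"
    have "x = w + of_int \<lfloor>x $ 1\<rfloor> *\<^sub>R axis 1 1 + of_int \<lfloor>x $ 2\<rfloor> *\<^sub>R axis 2 1"
      by (simp add: vec_eq_iff forall_2 w_def frac_def axis_def)
    then have "q x = q (w + of_int \<lfloor>x $ 1\<rfloor> *\<^sub>R axis 1 1 + of_int \<lfloor>x $ 2\<rfloor> *\<^sub>R axis 2 1)"
      by (rule arg_cong)
    then have "q x = q w" by (simp only: shift)
    moreover have "w \<in> cbox 0 1"
      by (auto simp: w_def mem_box_cart frac_lt_1 less_imp_le)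
    ultimately show ?thesis by blast
  qed
  then have "range q \<subseteq> q ` cbox 0 1" by blast
  moreover have "compact (q ` cbox 0 1)"
    by (rule compact_continuous_image[OF continuous_on_subset[OF cont]]) auto
  ultimately show ?thesis using compact_imp_bounded bounded_subset by blast
qed

lemma continuous_periodic_bounded:
  fixes p :: "real \<Rightarrow> 'b::metric_space"
  assumes cont: "continuous_on UNIV p" and per: "periodic_fun_simple p T" and T: "T > 0"
  shows "bounded (range p)"
proof -
  interpret periodic_fun_simple p T by (rule per)
  have "p x \<in> p ` {0..T}" for x
  proof -
    define w where "w = frac (x / T) * T"
    have "x = w + of_int \<lfloor>x / T\<rfloor> * T" using T by (simp add: w_def frac_def algebra_simps)
    then have "p x = p (w + of_int \<lfloor>x / T\<rfloor> * T)" by (rule arg_cong)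
    then have "p x = p w" by (simp only: plus_of_int)
    moreover have "w \<in> {0..T}" using T frac_lt_1[of "x / T"] frac_ge_0[of "x / T"]
      by (auto simp: w_def intro!: mult_left_le_one_le)
    ultimately show ?thesis by blast
  qed
  then have "range p \<subseteq> p ` {0..T}" by blast
  moreover have "compact (p ` {0..T})"
    by (rule compact_continuous_image[OF continuous_on_subset[OF cont]]) auto
  ultimately show ?thesis using compact_imp_bounded bounded_subset by blast
qed

text \<open>
  Iterating the shift gives \<open>p (n * \<alpha>) = p 0 + n * c\<close>, which is unbounded unless \<open>c = 0\<close>. This
  replaces averaging over a period: \<open>\<alpha>\<close> may be incommensurable with any period of \<open>p\<close>.
\<close>

lemma bounded_additive_shift_0:
  fixes p :: "real \<Rightarrow> real"
  assumes bdd: "bounded (range p)" and shift: "\<And>s. p (s + \<alpha>) = p s + c"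
  shows "c = 0"
proof (rule ccontr)
  assume "c \<noteq> 0"
  obtain B where B: "\<And>s. \<bar>p s\<bar> \<le> B" using bdd by (auto simp: bounded_iff)
  have it: "p (real n * \<alpha>) = p 0 + real n * c" for n
  proof (induction n)
    case (Suc n)
    then show ?case using shift[of "real n * \<alpha>"] by (simp add: algebra_simps)
  qed simp
  obtain n where n: "2 * B < real n * \<bar>c\<bar>"
    using reals_Archimedean3[of "\<bar>c\<bar>"] \<open>c \<noteq> 0\<close> by auto
  have "real n * \<bar>c\<bar> = \<bar>p (real n * \<alpha>) - p 0\<bar>" by (simp add: it abs_mult)
  also have "\<dots> \<le> 2 * B" using B[of "real n * \<alpha>"] B[of 0] by linarith
  finally show False using n by simp
qed

text \<open>
  Separating variables, \<open>f (s + \<alpha>) / f s\<close> is a constant, whose logarithm is an additive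
  shift of the bounded function \<open>ln \<circ> f\<close> and hence zero. Applied to the periodicity of the
  density, this shows that each factor is invariant under the corresponding component of every
  integer translation, even when the frame has irrational slope.
\<close>

lemma product_shift_invariant:
  fixes f g :: "real \<Rightarrow> real"
  assumes pos: "\<And>s. f s > 0" "\<And>t. g t > 0"
    and bdd: "bounded (range (\<lambda>s. ln (f s)))"
    and shift: "\<And>s t. f (s + \<alpha>) * g (t + \<beta>) = f s * g t"
  shows "f (s + \<alpha>) = f s"
proof -
  have "ln (f (s + \<alpha>)) = ln (f s) + (ln (g 0) - ln (g (0 + \<beta>)))" for s
    using arg_cong[OF shift[of s 0], of ln] pos by (simp add: ln_mult less_imp_neq[symmetric])
  moreover from this have "ln (g 0) - ln (g (0 + \<beta>)) = 0"
    by (rule bounded_additive_shift_0[OF bdd])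
  ultimately have "ln (f (s + \<alpha>)) = ln (f s)" by simp
  then show ?thesis using pos by simp
qed

text \<open>
  No continuity is available when this is used: the continuity of the density factors is deduced
  from the positivity of \<open>\<theta>\<^sub>1\<close> and \<open>\<theta>\<^sub>2\<close>. A nonnegative function with integral zero vanishes
  almost everywhere.
\<close>

lemma integral_pos_of_pos:
  fixes f :: "real \<Rightarrow> real"
  assumes int: "f integrable_on {a..b}" and pos: "\<And>s. f s > 0" and "a < b"
  shows "integral {a..b} f > 0"
proof -
  have "integral {a..b} f \<ge> 0" using int pos by (intro integral_nonneg) (auto simp: less_imp_le)
  moreover have "integral {a..b} f \<noteq> 0"
  proof
    assume 0: "integral {a..b} f = 0"
    have ai: "f absolutely_integrable_on {a..b}"
      using int pos by (intro nonnegative_absolutely_integrable_1) (auto simp: less_imp_le)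
    have "AE x in lebesgue. indicator {a..b} x *\<^sub>R f x = 0"
    proof (subst integral_nonneg_eq_0_iff_AE[symmetric])
      show "integrable lebesgue (\<lambda>x. indicator {a..b} x *\<^sub>R f x)"
        using ai by (simp add: set_integrable_def)
      show "(LINT x|lebesgue. indicator {a..b} x *\<^sub>R f x) = 0"
        using set_lebesgue_integral_eq_integral(2)[OF ai] 0 by (simp add: set_lebesgue_integral_def)
    qed (use pos in \<open>auto simp: less_imp_le indicator_def\<close>)
    then have "AE x in lebesgue. x \<notin> {a..b}"
      by eventually_elim (use pos in \<open>auto simp: indicator_def split: if_splits\<close>, metis less_irrefl)
    then have "{a..b} \<in> null_sets lebesgue"
      by (subst AE_iff_null_sets) auto
    then have "negligible {a..b}" by (simp add: negligible_iff_null_sets)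
    then show False using \<open>a < b\<close> negligible_interval(1)[of a b] by simp
  qed
  ultimately show ?thesis by simp
qed

text \<open>
  The condition on the mean says that \<open>R s - s\<close> is periodic for an antiderivative \<open>R\<close> of
  \<open>f / \<theta>\<close>. Being continuous, \<open>R s - s\<close> is then bounded. For any other \<open>\<alpha>\<close> that leaves \<open>f\<close>
  invariant, \<open>R (s + \<alpha>) - R s\<close> is constant in \<open>s\<close>, and boundedness forces the constant to be
  \<open>\<alpha>\<close>. The equation \<open>R (s + \<alpha>) = R s + \<alpha>\<close> is what makes the map built from such antiderivatives
  commute with integer translations.
\<close>

lemma normalised_antiderivative:
  fixes f :: "real \<Rightarrow> real"
  assumes cont: "continuous_on UNIV f" and mean: "periodic_with_unit_mean f"
    and \<theta>: "\<theta> = integral {0..1} f" "\<theta> \<noteq> 0"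
  obtains R where "\<And>s. (R has_real_derivative f s / \<theta>) (at s)"
    and "\<And>s \<alpha>. (\<And>s. f (s + \<alpha>) = f s) \<Longrightarrow> R (s + \<alpha>) = R s + \<alpha>"
proof -
  obtain T where T: "T > 0" "periodic_fun_simple f T" "integral {0..T} f = T * \<theta>"
    using mean \<theta> by (auto simp: periodic_with_unit_mean_def)
  interpret periodic_fun_simple f T by (rule T(2))
  have "\<exists>F. \<forall>s::real. -\<infinity> < ereal s \<longrightarrow> ereal s < \<infinity> \<longrightarrow> (F has_vector_derivative f s) (at s)"
    using cont by (intro einterval_antiderivative) (auto simp: continuous_on_eq_continuous_at)
  then obtain F where F: "\<And>s. (F has_real_derivative f s) (at s)"
    by (auto simp: has_real_derivative_iff_has_vector_derivative)
  define R where "R s = F s / \<theta>" for s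
  have R: "(R has_real_derivative f s / \<theta>) (at s)" for s
    unfolding R_def by (rule DERIV_cdivide[OF F])
  have shift: "R (s + \<alpha>) - R s = R \<alpha> - R 0" if "\<And>s. f (s + \<alpha>) = f s" for s \<alpha>
  proof -
    have "((\<lambda>s. R (s + \<alpha>) - R s) has_real_derivative 0) (at s)" for s
      using DERIV_diff[OF DERIV_shift[THEN iffD1, OF R[of "s + \<alpha>"]] R[of s]] that[of s] by simp
    then show ?thesis
      using DERIV_isconst_all[of "\<lambda>s. R (s + \<alpha>) - R s" s 0] by simp
  qed
  have "(f has_integral F T - F 0) {0..T}"
    using T(1) F by (intro fundamental_theorem_of_calculus)
      (auto simp: has_real_derivative_iff_has_vector_derivative[symmetric] intro: has_field_derivative_at_within)
  then have "R T - R 0 = T"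
    using T(3) \<theta>(2) by (simp add: R_def integral_unique diff_divide_distrib[symmetric])
  then have "periodic_fun_simple (\<lambda>s. R s - s) T"
    using shift[OF plus_period] by unfold_locales (simp add: algebra_simps)
  moreover have "continuous_on UNIV (\<lambda>s. R s - s)"
    by (intro continuous_intros DERIV_continuous_on[OF has_field_derivative_at_within[OF R]])
  ultimately have bdd: "bounded (range (\<lambda>s. R s - s))"
    using continuous_periodic_bounded T(1) by blast
  have "R (s + \<alpha>) = R s + \<alpha>" if "\<And>s. f (s + \<alpha>) = f s" for s \<alpha>
  proof -
    have "R \<alpha> - R 0 - \<alpha> = 0"
      by (rule bounded_additive_shift_0[OF bdd, of \<alpha>]) (use shift[OF that] in \<open>simp add: algebra_simps\<close>)
    then show ?thesis using shift[OF that, of s] by simp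
  qed
  then show ?thesis using that[OF R] by blast
qed

section \<open>Continuous maps at bounded distance from the identity\<close>

text \<open>
  If \<open>f\<close> moves points by at most \<open>B\<close>, then \<open>x \<mapsto> y + (x - f x)\<close> maps the ball of radius \<open>B\<close>
  around \<open>y\<close> into itself; Brouwer's theorem gives a fixed point, which is a preimage of \<open>y\<close>.
\<close>

lemma near_identity_surj:
  fixes f :: "'a::euclidean_space \<Rightarrow> 'a"
  assumes cont: "continuous_on UNIV f" and near: "bounded (range (\<lambda>x. f x - x))"
  shows "surj f"
proof -
  obtain B where B: "\<And>x. norm (f x - x) \<le> B" using near by (auto simp: bounded_iff)
  have B0: "B \<ge> 0" using B[of 0] norm_ge_zero order_trans by blast
  have "\<exists>x. f x = y" for y
  proof -
    have "\<exists>x\<in>cball y B. f x = y"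
    proof (rule brouwer_surjective[where S = "{y}"])
      show "x + (z - f z) \<in> cball y B" if "x \<in> {y}" for x z
        using that B[of z] by (simp add: dist_norm norm_minus_commute)
    qed (use B0 cont continuous_on_subset in auto)
    then show ?thesis by blast
  qed
  then show ?thesis by (metis surj_def)
qed

text \<open>
  Such a map is proper: preimages of a convergent sequence are bounded, so a subsequence converges.
\<close>

lemma near_identity_closed_map:
  fixes f :: "'a::euclidean_space \<Rightarrow> 'a"
  assumes cont: "continuous_on UNIV f" and near: "bounded (range (\<lambda>x. f x - x))" and C: "closed C"
  shows "closed (f ` C)"
  unfolding closed_sequential_limits
proof (intro allI impI, elim conjE)
  fix Y l assume Y: "\<forall>n. Y n \<in> f ` C" and l: "Y \<longlonglongrightarrow> l"
  obtain B where B: "\<And>x. norm (f x - x) \<le> B" using near by (auto simp: bounded_iff)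
  from Y have "\<forall>n. \<exists>x. x \<in> C \<and> Y n = f x" by blast
  from choice[OF this] obtain X where X: "\<And>n. X n \<in> C" "\<And>n. Y n = f (X n)" by blast
  obtain K where K: "\<And>n. norm (Y n) \<le> K"
    using convergent_imp_bounded[OF l] by (auto simp: bounded_iff)
  have "norm (X n) \<le> K + B" for n
    using norm_triangle_ineq4[of "Y n" "f (X n) - X n"] B[of "X n"] K[of n] X(2)[of n] by simp
  then have "bounded (range X)" by (auto simp: bounded_iff)
  then obtain m r where r: "strict_mono r" "(X \<circ> r) \<longlonglongrightarrow> m"
    using bounded_imp_convergent_subsequence[of X] by blast
  have "m \<in> C"
    using closed_sequentially[OF C _ r(2)] X(1) by auto
  moreover have "(\<lambda>n. f ((X \<circ> r) n)) \<longlonglongrightarrow> f m"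
    by (rule continuous_on_tendsto_compose[OF cont r(2)]) auto
  moreover have "(\<lambda>n. f ((X \<circ> r) n)) \<longlonglongrightarrow> l"
    using LIMSEQ_subseq_LIMSEQ[OF l r(1)] X(2) by (simp add: o_def)
  ultimately show "l \<in> f ` C" using LIMSEQ_unique by blast
qed

text \<open>
  A closed continuous surjection is a quotient map. This transfers continuity from \<open>\<rho> \<circ> \<nabla>P\<close>,
  where the Monge-Ampere equation provides it, to \<open>\<rho>\<close> itself, with no inverse of the
  mesh map involved.
\<close>

lemma near_identity_continuous_descends:
  fixes f :: "'a::euclidean_space \<Rightarrow> 'a" and g :: "'a \<Rightarrow> 'b::topological_space"
  assumes cont: "continuous_on UNIV f" and near: "bounded (range (\<lambda>x. f x - x))"
    and gf: "continuous_on UNIV (\<lambda>x. g (f x))"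
  shows "continuous_on UNIV g"
proof -
  have "closed (g -` C)" if "closed C" for C
  proof -
    have "g -` C = f ` ((\<lambda>x. g (f x)) -` C)"
      using near_identity_surj[OF cont near] by (auto simp: surj_def) (metis imageI vimageI)
    moreover have "closed ((\<lambda>x. g (f x)) -` C)"
      using gf that by (simp add: continuous_on_closed_vimage)
    ultimately show ?thesis
      using near_identity_closed_map[OF cont near] by simp
  qed
  then show ?thesis by (simp add: continuous_on_closed_vimage)
qed

section \<open>A periodic field with nonnegative divergence\<close>

text \<open>
  The integral of the divergence over a period cell is zero, since each component can be integrated
  first in its own coordinate direction, where periodicity cancels the boundary values. A nonnegative
  continuous function with integral zero vanishes. Taking \<open>z\<close> as the corner of the cell covers
  every point of the plane.
\<close>

lemma periodic_divergence_zero: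
  fixes G :: "real^2 \<Rightarrow> real^2" and DG :: "real^2 \<Rightarrow> real^2^2"
  assumes der: "\<And>z. (G has_derivative (\<lambda>h. DG z *v h)) (at z)"
    and cont: "continuous_on UNIV DG"
    and per: "doubly_periodic G"
    and nonneg: "\<And>z. trace (DG z) \<ge> 0"
  shows "trace (DG z) = 0"
proof -
  define w where "w s t = z + s *\<^sub>R axis 1 1 + t *\<^sub>R axis 2 1" for s t :: real
  have contD: "continuous_on S (\<lambda>p. DG (w (fst p) (snd p)) $ i $ i)" for i S
    unfolding w_def
    by (intro continuous_intros continuous_on_compose2[OF cont]) auto
  have line: "((\<lambda>s. G (y + s *\<^sub>R axis i 1) $ i) has_real_derivative DG (y + s *\<^sub>R axis i 1) $ i $ i) (at s)" for i y s
  proof -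
    have "((\<lambda>x. G x $ i) has_derivative (\<lambda>h. (DG z *v h) $ i)) (at z)" for z
      by (rule bounded_linear.has_derivative[OF bounded_linear_vec_nth der])
    from has_real_derivative_along_line[OF this, where y = y and s = s and u = "axis i 1"] show ?thesis
      by (simp add: matrix_vector_mult_basis column_def)
  qed
  have wper: "G (w 1 t) = G (w 0 t)" "G (w s 1) = G (w s 0)" for s t
  proof -
    have "w 1 t = w 0 t + axis 1 1" "w s 1 = w s 0 + axis 2 1" by (simp_all add: w_def)
    then show "G (w 1 t) = G (w 0 t)" "G (w s 1) = G (w s 0)"
      using per by (simp_all add: doubly_periodic_def)
  qed
  have "((\<lambda>s. G (w s t) $ 1) has_real_derivative DG (w s t) $ 1 $ 1) (at s within S)" for s t S
    using line[of "z + t *\<^sub>R axis 2 1" 1 s] by (simp add: w_def add_ac has_field_derivative_at_within)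
  then have "((\<lambda>s. DG (w s t) $ 1 $ 1) has_integral (G (w 1 t) $ 1 - G (w 0 t) $ 1)) {0..1}" for t
    by (intro fundamental_theorem_of_calculus) (auto simp: has_real_derivative_iff_has_vector_derivative)
  then have i1: "integral {0..1} (\<lambda>s. DG (w s t) $ 1 $ 1) = 0" for t
    by (simp add: wper integral_unique)
  have "((\<lambda>t. G (w s t) $ 2) has_real_derivative DG (w s t) $ 2 $ 2) (at t within S)" for s t S
    using line[of "z + s *\<^sub>R axis 1 1" 2 t] by (simp add: w_def has_field_derivative_at_within)
  then have "((\<lambda>t. DG (w s t) $ 2 $ 2) has_integral (G (w s 1) $ 2 - G (w s 0) $ 2)) {0..1}" for s
    by (intro fundamental_theorem_of_calculus) (auto simp: has_real_derivative_iff_has_vector_derivative)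
  then have i2: "integral {0..1} (\<lambda>t. DG (w s t) $ 2 $ 2) = 0" for s
    by (simp add: wper integral_unique)
  let ?Q = "cbox (0, 0) (1, 1) :: (real \<times> real) set"
  let ?d = "\<lambda>i p. DG (w (fst p) (snd p)) $ i $ i"
  have int: "?d i integrable_on ?Q" for i
    by (rule integrable_continuous[OF contD])
  have "integral ?Q (?d 1) = integral {0..1} (\<lambda>s. integral {0..1} (\<lambda>t. DG (w s t) $ 1 $ 1))"
    using integral_prod_continuous[OF contD, of 0 0 1 1 1] by simp
  also have "\<dots> = integral {0..1} (\<lambda>t. integral {0..1} (\<lambda>s. DG (w s t) $ 1 $ 1))"
    using integral_swap_continuous[of 0 0 1 1 "\<lambda>s t. DG (w s t) $ 1 $ 1"] contD[of ?Q 1]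
    by (simp add: case_prod_unfold)
  finally have "(?d 1 has_integral 0) ?Q"
    using integrable_integral[OF int[of 1]] by (simp add: i1)
  moreover have "(?d 2 has_integral 0) ?Q"
    using integrable_integral[OF int[of 2]] integral_prod_continuous[OF contD, of 0 0 1 1 2]
    by (simp add: i2)
  ultimately have "((\<lambda>p. ?d 1 p + ?d 2 p) has_integral 0 + 0) ?Q"
    by (rule has_integral_add)
  then have int0: "((\<lambda>p. trace (DG (w (fst p) (snd p)))) has_integral 0) ?Q"
    by (simp add: trace_def sum_2)
  have tr_cont: "continuous_on ?Q (\<lambda>p. trace (DG (w (fst p) (snd p))))"
    unfolding trace_def sum_2 by (intro continuous_on_add contD)
  have "box (0, 0) (1, 1) \<noteq> ({} :: (real \<times> real) set)"
    by (auto simp: box_ne_empty Basis_prod_def)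
  from has_integral_0_cbox_imp_0[OF tr_cont nonneg int0 this, of "(0, 0)"]
  show ?thesis by (simp add: w_def)
qed

section \<open>The Hessian of the Monge-Ampere solution\<close>

lemma continuous_on_matrix_mult:
  fixes A :: "'a::topological_space \<Rightarrow> real^'m^'n" and B :: "'a \<Rightarrow> real^'k^'m"
  assumes "continuous_on S A" "continuous_on S B"
  shows "continuous_on S (\<lambda>x. A x ** B x)"
  unfolding matrix_matrix_mult_def
  by (intro continuous_on_vec_lambda continuous_intros continuous_on_component assms)

text \<open>
  The field \<open>G\<close> of the proof is \<open>S \<circ> \<nabla>P - id\<close>, where \<open>S\<close> rescales each frame coordinate by its
  normalised antiderivative. Its derivative is \<open>A H - I\<close> with \<open>A\<close> the derivative of \<open>S\<close> and \<open>H\<close>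
  the Hessian, where \<open>det (A H) = 1\<close> by the Monge-Ampere equation. So its divergence
  \<open>tr (A H) - 2\<close> is nonnegative, hence zero by periodicity, and this is the equality case
  \<open>H = A\<^sup>-\<^sup>1\<close>.
\<close>

lemma hessian_frame_diag:
  fixes P :: "real^2 \<Rightarrow> real"
  assumes unit: "a\<^sup>2 + b\<^sup>2 = 1"
    and pos: "\<And>s. \<rho>\<^sub>1 s > 0" "\<And>s. \<rho>\<^sub>2 s > 0"
    and mean: "periodic_with_unit_mean \<rho>\<^sub>1" "periodic_with_unit_mean \<rho>\<^sub>2"
    and \<rho>: "\<rho> = (\<lambda>y. \<rho>\<^sub>1 (y \<bullet> vector [a, b]) * \<rho>\<^sub>2 (y \<bullet> vector [- b, a]))"
    and \<rho>_per: "doubly_periodic \<rho>"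
    and \<theta>: "\<theta>\<^sub>1 = integral {0..1} \<rho>\<^sub>1" "\<theta>\<^sub>2 = integral {0..1} \<rho>\<^sub>2" "\<theta>\<^sub>1 > 0" "\<theta>\<^sub>2 > 0"
    and MA: "doubly_periodic_MA_solution \<rho> (\<theta>\<^sub>1 * \<theta>\<^sub>2) P"
  shows "hessian P \<xi> = frame_diag a b (\<theta>\<^sub>1 / \<rho>\<^sub>1 (gradient P \<xi> \<bullet> vector [a, b]))
                                     (\<theta>\<^sub>2 / \<rho>\<^sub>2 (gradient P \<xi> \<bullet> vector [- b, a]))"
proof -
  let ?u = "vector [a, b] :: real^2" and ?v = "vector [- b, a] :: real^2"
  have c2: "twice_continuously_differentiable P" and conv: "convex_on UNIV P"
    and P_per: "doubly_periodic (\<lambda>\<xi>. P \<xi> - (norm \<xi>)\<^sup>2 / 2)"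
    and eq: "\<And>\<xi>. \<rho> (gradient P \<xi>) * det (hessian P \<xi>) = \<theta>\<^sub>1 * \<theta>\<^sub>2"
    using MA by (auto simp: doubly_periodic_MA_solution_def)
  have Pd: "\<And>y. P differentiable at y" and H_cont: "continuous_on UNIV (hessian P)"
    using c2 by (auto simp: twice_continuously_differentiable_def)
  have Hd: "(gradient P has_derivative (\<lambda>k. hessian P z *v k)) (at z)" for z
    using c2 by (simp add: jacobian_works hessian_def twice_continuously_differentiable_def)
  have g_cont: "continuous_on UNIV (gradient P)"
    using Hd has_derivative_continuous by (fastforce simp: continuous_on_eq_continuous_at)
  have g_shift: "gradient P (\<xi> + axis i 1) = gradient P \<xi> + axis i 1" for \<xi> i
    by (rule gradient_shift[OF Pd P_per])
  have near: "bounded (range (\<lambda>\<xi>. gradient P \<xi> - \<xi>))"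
    by (intro doubly_periodic_bounded continuous_intros g_cont)
       (simp add: doubly_periodic_def g_shift)

  \<comment> \<open>The density is continuous: along the mesh map it is a quotient of continuous functions.\<close>
  have \<rho>_pos: "\<rho> y > 0" for y using pos by (simp add: \<rho>)
  have det_pos: "det (hessian P \<xi>) > 0" for \<xi>
    using eq[of \<xi>] \<rho>_pos[of "gradient P \<xi>"] \<theta>(3,4) by (metis mult_pos_pos zero_less_mult_pos)
  have "\<rho> (gradient P \<xi>) = \<theta>\<^sub>1 * \<theta>\<^sub>2 / det (hessian P \<xi>)" for \<xi>
    using eq[of \<xi>] det_pos[of \<xi>] by (simp add: field_simps)
  moreover have "continuous_on UNIV (\<lambda>\<xi>. \<theta>\<^sub>1 * \<theta>\<^sub>2 / det (hessian P \<xi>))"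
    using det_pos unfolding det_2
    by (intro continuous_intros continuous_on_component H_cont) (auto simp: less_imp_neq[symmetric] det_2)
  ultimately have "continuous_on UNIV (\<lambda>\<xi>. \<rho> (gradient P \<xi>))" by simp
  then have \<rho>_cont: "continuous_on UNIV \<rho>"
    by (rule near_identity_continuous_descends[OF g_cont near])

  have uv: "?u \<bullet> ?u = 1" "?v \<bullet> ?v = 1" "?u \<bullet> ?v = 0" "?v \<bullet> ?u = 0"
    using unit by (auto simp: inner_vec_def sum_2 power2_eq_square)
  have \<rho>_frame: "\<rho> (s *\<^sub>R ?u + t *\<^sub>R ?v) = \<rho>\<^sub>1 s * \<rho>\<^sub>2 t" for s t
    by (simp add: \<rho> inner_add_left uv)
  have cont1: "continuous_on UNIV \<rho>\<^sub>1"
  proof -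
    have eq: "\<rho>\<^sub>1 = (\<lambda>s. \<rho> (s *\<^sub>R ?u + 0 *\<^sub>R ?v) / \<rho>\<^sub>2 0)"
      unfolding \<rho>_frame using pos(2)[of 0] by simp
    show ?thesis
      using pos(2)[of 0] by (subst eq, intro continuous_intros continuous_on_compose2[OF \<rho>_cont]) auto
  qed
  have cont2: "continuous_on UNIV \<rho>\<^sub>2"
  proof -
    have eq: "\<rho>\<^sub>2 = (\<lambda>t. \<rho> (0 *\<^sub>R ?u + t *\<^sub>R ?v) / \<rho>\<^sub>1 0)"
      unfolding \<rho>_frame using pos(1)[of 0] by simp
    show ?thesis
      using pos(1)[of 0] by (subst eq, intro continuous_intros continuous_on_compose2[OF \<rho>_cont]) auto
  qed

  have prod_shift: "\<rho>\<^sub>1 (s + ?u $ i) * \<rho>\<^sub>2 (t + ?v $ i) = \<rho>\<^sub>1 s * \<rho>\<^sub>2 t" for s t i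
  proof -
    have "\<rho> ((s *\<^sub>R ?u + t *\<^sub>R ?v) + axis i 1) = \<rho>\<^sub>1 s * \<rho>\<^sub>2 t"
      using \<rho>_per by (simp add: doubly_periodic_def \<rho>_frame)
    then show ?thesis by (simp add: \<rho> inner_add_left uv inner_axis' )
  qed
  have ln_bdd: "bounded (range (\<lambda>s. ln (f s)))"
    if f: "continuous_on UNIV f" "periodic_with_unit_mean f" "\<And>s. f s > 0" for f :: "real \<Rightarrow> real"
  proof -
    obtain T where T: "T > 0" "periodic_fun_simple f T"
      using f(2) by (auto simp: periodic_with_unit_mean_def)
    then have "periodic_fun_simple (\<lambda>s. ln (f s)) T"
      by (simp add: periodic_fun_simple_def)
    moreover have "continuous_on UNIV (\<lambda>s. ln (f s))"
      using f(1,3) by (intro continuous_intros) (auto simp: less_imp_neq[symmetric])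
    ultimately show ?thesis using continuous_periodic_bounded T(1) by blast
  qed
  have shift1: "\<rho>\<^sub>1 (s + ?u $ i) = \<rho>\<^sub>1 s" for s i
    by (rule product_shift_invariant[where g = \<rho>\<^sub>2 and \<beta> = "?v $ i"])
       (intro pos ln_bdd cont1 mean prod_shift)+
  have prod_shift': "\<rho>\<^sub>2 (t + ?v $ i) * \<rho>\<^sub>1 (s + ?u $ i) = \<rho>\<^sub>2 t * \<rho>\<^sub>1 s" for s t i
    using prod_shift[of s i t] by (simp add: mult.commute)
  have shift2: "\<rho>\<^sub>2 (t + ?v $ i) = \<rho>\<^sub>2 t" for t i
    by (rule product_shift_invariant[where g = \<rho>\<^sub>1 and \<beta> = "?u $ i"])
       (intro pos ln_bdd cont2 mean prod_shift')+

  obtain R\<^sub>1 where R1: "\<And>s. (R\<^sub>1 has_real_derivative \<rho>\<^sub>1 s / \<theta>\<^sub>1) (at s)"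
    and R1_shift: "\<And>s \<alpha>. (\<And>s. \<rho>\<^sub>1 (s + \<alpha>) = \<rho>\<^sub>1 s) \<Longrightarrow> R\<^sub>1 (s + \<alpha>) = R\<^sub>1 s + \<alpha>"
    using normalised_antiderivative[OF cont1 mean(1) \<theta>(1)] \<theta>(3) less_imp_neq by blast
  obtain R\<^sub>2 where R2: "\<And>s. (R\<^sub>2 has_real_derivative \<rho>\<^sub>2 s / \<theta>\<^sub>2) (at s)"
    and R2_shift: "\<And>s \<alpha>. (\<And>s. \<rho>\<^sub>2 (s + \<alpha>) = \<rho>\<^sub>2 s) \<Longrightarrow> R\<^sub>2 (s + \<alpha>) = R\<^sub>2 s + \<alpha>"
    using normalised_antiderivative[OF cont2 mean(2) \<theta>(2)] \<theta>(4) less_imp_neq by blast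
  define \<alpha> where "\<alpha> \<xi> = \<rho>\<^sub>1 (gradient P \<xi> \<bullet> ?u) / \<theta>\<^sub>1" for \<xi>
  define \<beta> where "\<beta> \<xi> = \<rho>\<^sub>2 (gradient P \<xi> \<bullet> ?v) / \<theta>\<^sub>2" for \<xi>
  define G where "G \<xi> = R\<^sub>1 (gradient P \<xi> \<bullet> ?u) *\<^sub>R ?u + R\<^sub>2 (gradient P \<xi> \<bullet> ?v) *\<^sub>R ?v - \<xi>" for \<xi>
  define DG where "DG \<xi> = frame_diag a b (\<alpha> \<xi>) (\<beta> \<xi>) ** hessian P \<xi> - mat 1" for \<xi>
  have ab_pos: "\<alpha> \<xi> > 0" "\<beta> \<xi> > 0" for \<xi>
    using pos \<theta>(3,4) by (simp_all add: \<alpha>_def \<beta>_def)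
  have ab_det: "\<alpha> \<xi> * \<beta> \<xi> * det (hessian P \<xi>) = 1" for \<xi>
    using eq[of \<xi>] \<theta>(3,4) by (simp add: \<rho> \<alpha>_def \<beta>_def field_simps)
  have H_sym: "hessian P \<xi> $ 1 $ 2 = hessian P \<xi> $ 2 $ 1" for \<xi>
    using hessian_symmetric[OF c2, of "axis 1 1" \<xi> "axis 2 1"]
    by (simp add: matrix_vector_mult_basis column_def inner_axis')
  note trace_bound = trace_frame_diag_mult_ge_2[OF unit H_sym hessian_psd[OF c2 conv] ab_pos ab_det]
  have trace_DG: "trace (DG z) = trace (frame_diag a b (\<alpha> z) (\<beta> z) ** hessian P z) - 2" for z
    by (simp add: DG_def trace_sub trace_I)
  have "trace (DG \<xi>) = 0"
  proof (rule periodic_divergence_zero)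
    show "(G has_derivative (\<lambda>h. DG z *v h)) (at z)" for z
    proof -
      have "((\<lambda>\<xi>. R\<^sub>1 (gradient P \<xi> \<bullet> ?u)) has_derivative (\<lambda>h. \<alpha> z * ((hessian P z *v h) \<bullet> ?u))) (at z)"
        using has_derivative_compose[OF has_derivative_inner_left[OF Hd] R1[unfolded has_field_derivative_def]]
        by (simp add: \<alpha>_def)
      moreover have "((\<lambda>\<xi>. R\<^sub>2 (gradient P \<xi> \<bullet> ?v)) has_derivative (\<lambda>h. \<beta> z * ((hessian P z *v h) \<bullet> ?v))) (at z)"
        using has_derivative_compose[OF has_derivative_inner_left[OF Hd] R2[unfolded has_field_derivative_def]]
        by (simp add: \<beta>_def)
      ultimately have "(G has_derivative (\<lambda>h. (\<alpha> z * ((hessian P z *v h) \<bullet> ?u)) *\<^sub>R ?u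
          + (\<beta> z * ((hessian P z *v h) \<bullet> ?v)) *\<^sub>R ?v - h)) (at z)"
        unfolding G_def by (intro has_derivative_diff has_derivative_add has_derivative_scaleR_left has_derivative_ident)
      moreover have "DG z *v h = (\<alpha> z * ((hessian P z *v h) \<bullet> ?u)) *\<^sub>R ?u
          + (\<beta> z * ((hessian P z *v h) \<bullet> ?v)) *\<^sub>R ?v - h" for h
        by (simp add: DG_def matrix_vector_mult_diff_rdistrib frame_diag_mult_vec flip: matrix_vector_mul_assoc)
      ultimately show ?thesis by simp
    qed
    have "continuous_on UNIV \<alpha>" "continuous_on UNIV \<beta>"
      unfolding \<alpha>_def \<beta>_def using \<theta>(3,4)
      by (auto intro!: continuous_intros g_cont continuous_on_compose2[OF cont1] continuous_on_compose2[OF cont2])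
    then show "continuous_on UNIV DG"
      unfolding DG_def frame_diag_def by (intro continuous_intros continuous_on_matrix_mult H_cont)
    show "doubly_periodic G"
      unfolding doubly_periodic_def
    proof (intro allI)
      fix z :: "real^2" and i :: 2
      have "G (z + axis i 1) = G z + ((?u $ i) *\<^sub>R ?u + (?v $ i) *\<^sub>R ?v - axis i 1)"
        by (simp add: G_def g_shift inner_add_left inner_axis' R1_shift[OF shift1] R2_shift[OF shift2]
            scaleR_add_left)
      then show "G (z + axis i 1) = G z"
        using frame_expansion[OF unit, of "axis i 1"] by (simp add: inner_axis')
    qed
    show "trace (DG z) \<ge> 0" for z
      using trace_bound(1)[of z] by (simp add: trace_DG)
  qed
  then have "hessian P \<xi> = frame_diag a b (1 / \<alpha> \<xi>) (1 / \<beta> \<xi>)"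
    using trace_bound(2)[of \<xi>] by (simp add: trace_DG)
  then show ?thesis by (simp add: \<alpha>_def \<beta>_def)
qed

section \<open>Alignment of the mesh\<close>

theorem mainTheorem1:
  fixes a b \<theta>\<^sub>1 \<theta>\<^sub>2 \<theta> :: real
    and e\<^sub>1 e\<^sub>2 :: "real^2"
    and \<rho>\<^sub>1 \<rho>\<^sub>2 :: "real \<Rightarrow> real"
    and \<rho> P :: "real^2 \<Rightarrow> real"
    and x :: "real^2 \<Rightarrow> real^2"
    and J M :: "real^2 \<Rightarrow> real^2^2"
  assumes "a\<^sup>2 + b\<^sup>2 = 1"
    and "e\<^sub>1 = vector [a, b]" and "e\<^sub>2 = vector [- b, a]"
    and "\<forall>s. \<rho>\<^sub>1 s > 0" and "\<forall>s. \<rho>\<^sub>2 s > 0"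
    and "\<rho>\<^sub>1 integrable_on {0..1}" and "\<rho>\<^sub>2 integrable_on {0..1}"
    and "periodic_with_unit_mean \<rho>\<^sub>1" and "periodic_with_unit_mean \<rho>\<^sub>2"
    and "\<rho> = (\<lambda>y. \<rho>\<^sub>1 (y \<bullet> e\<^sub>1) * \<rho>\<^sub>2 (y \<bullet> e\<^sub>2))"
    and "doubly_periodic \<rho>"
    and "\<theta>\<^sub>1 = integral {0..1} \<rho>\<^sub>1" and "\<theta>\<^sub>2 = integral {0..1} \<rho>\<^sub>2"
    and "\<theta> = \<theta>\<^sub>1 * \<theta>\<^sub>2"
    and "doubly_periodic_MA_solution \<rho> \<theta> P"
    and "x = gradient P"
    and "J = (\<lambda>\<xi>. jacobian x (at \<xi>))"
    and "M = (\<lambda>\<xi>. metric_tensor \<theta> (J \<xi>))"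
  shows "\<forall>\<xi>. \<forall>r\<^sub>1 r\<^sub>2. r\<^sub>1 = \<rho>\<^sub>1 (x \<xi> \<bullet> e\<^sub>1) \<longrightarrow> r\<^sub>2 = \<rho>\<^sub>2 (x \<xi> \<bullet> e\<^sub>2) \<longrightarrow>
      (J \<xi> = (\<theta>\<^sub>1 / r\<^sub>1) *\<^sub>R outer e\<^sub>1 e\<^sub>1 + (\<theta>\<^sub>2 / r\<^sub>2) *\<^sub>R outer e\<^sub>2 e\<^sub>2
       \<and> eigenvalues (J \<xi>) = {# \<theta>\<^sub>1 / r\<^sub>1, \<theta>\<^sub>2 / r\<^sub>2 #}
       \<and> singular_values (J \<xi>) = {# \<theta>\<^sub>1 / r\<^sub>1, \<theta>\<^sub>2 / r\<^sub>2 #})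
    \<and> (M \<xi> = (\<theta>\<^sub>2 * r\<^sub>1\<^sup>2 / \<theta>\<^sub>1) *\<^sub>R outer e\<^sub>1 e\<^sub>1 + (\<theta>\<^sub>1 * r\<^sub>2\<^sup>2 / \<theta>\<^sub>2) *\<^sub>R outer e\<^sub>2 e\<^sub>2
       \<and> is_eigenvector (M \<xi>) (\<theta>\<^sub>2 * r\<^sub>1\<^sup>2 / \<theta>\<^sub>1) e\<^sub>1
       \<and> is_eigenvector (M \<xi>) (\<theta>\<^sub>1 * r\<^sub>2\<^sup>2 / \<theta>\<^sub>2) e\<^sub>2
       \<and> eigenvalues (M \<xi>) = {# \<theta>\<^sub>2 * r\<^sub>1\<^sup>2 / \<theta>\<^sub>1, \<theta>\<^sub>1 * r\<^sub>2\<^sup>2 / \<theta>\<^sub>2 #}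
       \<and> M \<xi> = (\<theta>\<^sub>1 * r\<^sub>2\<^sup>2 / \<theta>\<^sub>2) *\<^sub>R
           (mat 1 + (\<theta>\<^sub>2\<^sup>2 * r\<^sub>1\<^sup>2 / (\<theta>\<^sub>1\<^sup>2 * r\<^sub>2\<^sup>2) - 1) *\<^sub>R outer e\<^sub>1 e\<^sub>1))
    \<and> anisotropy (J \<xi>) =
         1 / 2 * (\<theta>\<^sub>1 * r\<^sub>2 / (\<theta>\<^sub>2 * r\<^sub>1) + \<theta>\<^sub>2 * r\<^sub>1 / (\<theta>\<^sub>1 * r\<^sub>2))"
proof (intro allI impI)
  note e = assms(2,3) and \<theta> = assms(12-14) and x = assms(16) and J = assms(17) and M = assms(18)
  have pos: "\<rho>\<^sub>1 s > 0" "\<rho>\<^sub>2 s > 0" for s using assms(4,5) by auto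
  have \<theta>_pos: "\<theta>\<^sub>1 > 0" "\<theta>\<^sub>2 > 0"
    unfolding \<theta> using assms(6,7) pos by (auto intro: integral_pos_of_pos)
  fix \<xi> r\<^sub>1 r\<^sub>2
  assume r: "r\<^sub>1 = \<rho>\<^sub>1 (x \<xi> \<bullet> e\<^sub>1)" "r\<^sub>2 = \<rho>\<^sub>2 (x \<xi> \<bullet> e\<^sub>2)"
  have r_pos: "r\<^sub>1 > 0" "r\<^sub>2 > 0" using pos by (auto simp: r)
  note frame = frame_diag_def[of a b, folded e]
  have "hessian P \<xi> = frame_diag a b (\<theta>\<^sub>1 / r\<^sub>1) (\<theta>\<^sub>2 / r\<^sub>2)"
    unfolding r x e
    by (rule hessian_frame_diag[OF assms(1) pos assms(8,9) assms(10)[unfolded e] assms(11) assms(12,13) \<theta>_pos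
          assms(15)[unfolded \<theta>(3)]])
  then have JF: "J \<xi> = frame_diag a b (\<theta>\<^sub>1 / r\<^sub>1) (\<theta>\<^sub>2 / r\<^sub>2)"
    by (simp add: J x hessian_def)
  have "M \<xi> = frame_diag a b (\<theta> / (\<theta>\<^sub>1 / r\<^sub>1)\<^sup>2) (\<theta> / (\<theta>\<^sub>2 / r\<^sub>2)\<^sup>2)"
    unfolding M JF using r_pos \<theta>_pos by (intro metric_tensor_frame_diag[OF assms(1)]) auto
  also have "\<theta> / (\<theta>\<^sub>1 / r\<^sub>1)\<^sup>2 = \<theta>\<^sub>2 * r\<^sub>1\<^sup>2 / \<theta>\<^sub>1"
    using \<theta>_pos r_pos by (simp add: \<theta>(3) field_simps power2_eq_square)
  also have "\<theta> / (\<theta>\<^sub>2 / r\<^sub>2)\<^sup>2 = \<theta>\<^sub>1 * r\<^sub>2\<^sup>2 / \<theta>\<^sub>2"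
    using \<theta>_pos r_pos by (simp add: \<theta>(3) field_simps power2_eq_square)
  finally have MF: "M \<xi> = frame_diag a b (\<theta>\<^sub>2 * r\<^sub>1\<^sup>2 / \<theta>\<^sub>1) (\<theta>\<^sub>1 * r\<^sub>2\<^sup>2 / \<theta>\<^sub>2)" .
  have ratio: "\<theta>\<^sub>2 * r\<^sub>1\<^sup>2 / \<theta>\<^sub>1 / (\<theta>\<^sub>1 * r\<^sub>2\<^sup>2 / \<theta>\<^sub>2) = \<theta>\<^sub>2\<^sup>2 * r\<^sub>1\<^sup>2 / (\<theta>\<^sub>1\<^sup>2 * r\<^sub>2\<^sup>2)"
    by (simp add: power2_eq_square ac_simps)
  have "M \<xi> = (\<theta>\<^sub>1 * r\<^sub>2\<^sup>2 / \<theta>\<^sub>2) *\<^sub>R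
           (mat 1 + (\<theta>\<^sub>2\<^sup>2 * r\<^sub>1\<^sup>2 / (\<theta>\<^sub>1\<^sup>2 * r\<^sub>2\<^sup>2) - 1) *\<^sub>R outer e\<^sub>1 e\<^sub>1)"
    unfolding MF ratio[symmetric] e
    by (rule frame_diag_rank_one_update[OF assms(1)]) (use \<theta>_pos r_pos in auto)
  moreover have "anisotropy (J \<xi>) =
         1 / 2 * (\<theta>\<^sub>1 * r\<^sub>2 / (\<theta>\<^sub>2 * r\<^sub>1) + \<theta>\<^sub>2 * r\<^sub>1 / (\<theta>\<^sub>1 * r\<^sub>2))"
    unfolding JF using \<theta>_pos r_pos
    by (subst anisotropy_frame_diag[OF assms(1)]) (simp_all add: mult.commute)
  moreover have "singular_values (J \<xi>) = {# \<theta>\<^sub>1 / r\<^sub>1, \<theta>\<^sub>2 / r\<^sub>2 #}"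
    unfolding JF using \<theta>_pos r_pos by (intro singular_values_frame_diag[OF assms(1)]) auto
  moreover have "eigenvalues (J \<xi>) = {# \<theta>\<^sub>1 / r\<^sub>1, \<theta>\<^sub>2 / r\<^sub>2 #}"
    "eigenvalues (M \<xi>) = {# \<theta>\<^sub>2 * r\<^sub>1\<^sup>2 / \<theta>\<^sub>1, \<theta>\<^sub>1 * r\<^sub>2\<^sup>2 / \<theta>\<^sub>2 #}"
    unfolding JF MF by (rule eigenvalues_frame_diag[OF assms(1)])+
  moreover have "is_eigenvector (M \<xi>) (\<theta>\<^sub>2 * r\<^sub>1\<^sup>2 / \<theta>\<^sub>1) e\<^sub>1" "is_eigenvector (M \<xi>) (\<theta>\<^sub>1 * r\<^sub>2\<^sup>2 / \<theta>\<^sub>2) e\<^sub>2"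
    unfolding MF e by (rule is_eigenvector_frame_diag[OF assms(1)])+
  ultimately show "(J \<xi> = (\<theta>\<^sub>1 / r\<^sub>1) *\<^sub>R outer e\<^sub>1 e\<^sub>1 + (\<theta>\<^sub>2 / r\<^sub>2) *\<^sub>R outer e\<^sub>2 e\<^sub>2
       \<and> eigenvalues (J \<xi>) = {# \<theta>\<^sub>1 / r\<^sub>1, \<theta>\<^sub>2 / r\<^sub>2 #}
       \<and> singular_values (J \<xi>) = {# \<theta>\<^sub>1 / r\<^sub>1, \<theta>\<^sub>2 / r\<^sub>2 #})
    \<and> (M \<xi> = (\<theta>\<^sub>2 * r\<^sub>1\<^sup>2 / \<theta>\<^sub>1) *\<^sub>R outer e\<^sub>1 e\<^sub>1 + (\<theta>\<^sub>1 * r\<^sub>2\<^sup>2 / \<theta>\<^sub>2) *\<^sub>R outer e\<^sub>2 e\<^sub>2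
       \<and> is_eigenvector (M \<xi>) (\<theta>\<^sub>2 * r\<^sub>1\<^sup>2 / \<theta>\<^sub>1) e\<^sub>1
       \<and> is_eigenvector (M \<xi>) (\<theta>\<^sub>1 * r\<^sub>2\<^sup>2 / \<theta>\<^sub>2) e\<^sub>2
       \<and> eigenvalues (M \<xi>) = {# \<theta>\<^sub>2 * r\<^sub>1\<^sup>2 / \<theta>\<^sub>1, \<theta>\<^sub>1 * r\<^sub>2\<^sup>2 / \<theta>\<^sub>2 #}
       \<and> M \<xi> = (\<theta>\<^sub>1 * r\<^sub>2\<^sup>2 / \<theta>\<^sub>2) *\<^sub>R
           (mat 1 + (\<theta>\<^sub>2\<^sup>2 * r\<^sub>1\<^sup>2 / (\<theta>\<^sub>1\<^sup>2 * r\<^sub>2\<^sup>2) - 1) *\<^sub>R outer e\<^sub>1 e\<^sub>1))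
    \<and> anisotropy (J \<xi>) =
         1 / 2 * (\<theta>\<^sub>1 * r\<^sub>2 / (\<theta>\<^sub>2 * r\<^sub>1) + \<theta>\<^sub>2 * r\<^sub>1 / (\<theta>\<^sub>1 * r\<^sub>2))"
    using JF[unfolded frame] MF[unfolded frame] by blast
qed

end
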